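(* Let $\beta$ be the tribonacci number, i.e. the unique root in $(1,2)$ of $x^3=x^2+x+1$. Then $$S_\beta(3m+1)=\begin{cases}\dfrac{1+\beta+\beta^{3z+2}-\beta^{3z+1}-\beta^{6z}-\beta^{6z+2}}{(1-\beta^3)(\beta^{6z+1}-1)}, & m=2z,\ z\ge 1,\\[2mm] \dfrac{1+\beta+\beta^{3z+5}-\beta^{3z+4}-\beta^{6z+3}-\beta^{6z+5}}{(1-\beta^3)(\beta^{6z+4}-1)}, & m=2z+1,\ z\ge 1,\end{cases}$$ where $m,z$ denote integers. Moreover, along the periods $p=3m+1$, $m\ge 2$, the value $S_\beta(p)$ is increasing in $p$ and converges to $\frac{\beta^2+1}{\beta^4-\beta}$ as $p\to\infty$.
   Context: For $\beta\in(1,2]$ let $T_\beta:[0,1)\to[0,1)$, $T_\beta(x)=\beta x \pmod 1$. For $t\in[0,1)$ the survivor set is $K_\beta(t)=\{x\in[0,1): T_\beta^n(x)\ge t \text{ for all } n\ge 0\}$. A point $x$ has smallest period $p$ if $T_\beta^p(x)=x$ and $T_\beta^j(x)\ne x$ for all $1\le j<p$. For a positive integer $p$, $$S_\beta(p)=\sup\{t\in[0,1): K_\beta(t)\text{ contains a point of smallest period } p\}.$$ *)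

theory Defs
  imports Complex_Main
begin

definition beta_map :: "real \<Rightarrow> real \<Rightarrow> real" where
  "beta_map \<beta> x = frac (\<beta> * x)"

definition survivor_set :: "real \<Rightarrow> real \<Rightarrow> real set" where
  "survivor_set \<beta> t = {x \<in> {0..<1}. \<forall>n. t \<le> (beta_map \<beta> ^^ n) x}"

definition has_smallest_period :: "('a \<Rightarrow> 'a) \<Rightarrow> 'a \<Rightarrow> nat \<Rightarrow> bool" where
  "has_smallest_period f x p \<longleftrightarrow>
     0 < p \<and> (f ^^ p) x = x \<and> (\<forall>j. 1 \<le> j \<and> j < p \<longrightarrow> (f ^^ j) x \<noteq> x)"

(* The supremum is taken in the reals, where Sup {} is an unspecified value.
   The set is always bounded above by 1, and it contains t = 0 as soon as
   beta_map \<beta> has some point of smallest period p in [0,1). *)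
definition S_period :: "real \<Rightarrow> nat \<Rightarrow> real" where
  "S_period \<beta> p =
     Sup {t \<in> {0..<1}. \<exists>x \<in> survivor_set \<beta> t. has_smallest_period (beta_map \<beta>) x p}"

lemma tribonacci_ex1: "\<exists>!x::real. 1 < x \<and> x < 2 \<and> x ^ 3 = x ^ 2 + x + 1"
proof -
  have "\<exists>x\<ge>1. x \<le> 2 \<and> (\<lambda>x::real. x ^ 3 - x ^ 2 - x - 1) x = 0"
    by (rule IVT') (auto intro!: continuous_intros)
  then obtain x :: real where x: "1 \<le> x" "x \<le> 2" "x ^ 3 = x ^ 2 + x + 1"
    by auto
  have "x \<noteq> 1" "x \<noteq> 2"
    using x(3) by auto
  with x have ex: "1 < x \<and> x < 2 \<and> x ^ 3 = x ^ 2 + x + 1"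
    by simp
  have less: False
    if "1 < y" "y < z" "y ^ 3 = y ^ 2 + y + 1" "z ^ 3 = z ^ 2 + z + 1" for y z :: real
  proof -
    have "(z - y) * (z ^ 2 + z * y + y ^ 2 - z - y - 1) = 0"
      using that(3,4) by (simp add: algebra_simps power2_eq_square power3_eq_cube)
    with that(2) have eq: "z ^ 2 + z * y + y ^ 2 - z - y - 1 = 0"
      by simp
    have "z * 1 < z * z" "y * 1 < y * y" "1 * 1 < z * y"
      using that(1,2) by (intro mult_strict_left_mono mult_strict_mono; simp)+
    with eq show False
      by (simp add: power2_eq_square)
  qed
  show ?thesis
    using ex less by (metis linorder_neqE_linordered_idom)
qed

definition tribonacci :: real where
  "tribonacci = (THE x. 1 < x \<and> x < 2 \<and> x ^ 3 = x ^ 2 + x + 1)"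

end

theory Submission
  imports Defs
begin

text \<open>
  Write \<open>T\<close> for the map \<open>x \<mapsto> \<beta> x mod 1\<close> and expand points in binary digits along their orbits.
  As \<open>1 = 1/\<beta> + 1/\<beta>\<^sup>2 + 1/\<beta>\<^sup>3\<close>, no orbit has three consecutive digits 1. Since order is
  lexicographic, a periodic orbit with a large minimum should avoid 00, so its word should be a
  product of blocks 01 and 011, and its smallest points are those that start with 010. A period
  congruent to 1 modulo 3 needs at least two blocks 01; the best choice has exactly two, spread as
  evenly as the requirement of a primitive word permits. So the optimal words are
  \<open>01(011)\<^sup>r01(011)\<^sup>q\<close> with \<open>q = r + 1\<close> or \<open>q = r + 2\<close>; \<open>q = r\<close> would halve the period.

  The argument is carried out without words. In the coordinate \<open>P s = 1/\<beta> - s/\<beta>\<^sup>4\<close> (decreasing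
  in \<open>s\<close>), block 011 acts as \<open>s \<mapsto> \<beta>\<^sup>3 s\<close> and block 01 as \<open>s \<mapsto> \<beta>\<^sup>2 (s - 1)\<close>, and the points
  starting with 010 are those with \<open>1 < s \<le> 1 + \<beta>\<close>. Putting \<open>s = 1 + v\<close>, the first return to
  these points is \<open>v \<mapsto> \<beta>\<^sup>l v - 1\<close>, where \<open>l\<close> is the least number congruent to 2 modulo 3 that
  makes this positive (\<open>first_return\<close>). An orbit of period \<open>n + N\<close> with two returns of lengths
  \<open>n\<close> and \<open>N\<close> starts at \<open>v = \<phi> n N = (\<beta>\<^sup>N + 1) / (\<beta>\<^bsup>n+N\<^esup> - 1)\<close>.

  The value of the supremum, \<open>P (1 + \<phi> n N)\<close> with \<open>N = n + 3\<close> or \<open>N = n + 6\<close>, has two halves. The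
  orbit of this point stays above it (\<open>word_orbit\<close>). Conversely, an orbit of the same period that
  stays strictly above it has all \<open>v < \<phi> n N\<close>, so all its returns are long; together with
  their residues modulo 3 this leaves exactly two returns, and the longer of them forces a \<open>v \<ge> \<phi> n N\<close>
  (\<open>orbit_reaches_word\<close>). Monotonicity and the limit follow because \<open>\<phi>\<close> is strictly decreasing in
  both arguments and tends to 0; the limit is \<open>P 1\<close>, the point with expansion 0110000...
\<close>

section \<open>Periods and residues modulo 3\<close>

lemma has_smallest_period_shift:
  assumes "has_smallest_period f x p"
  shows "has_smallest_period f ((f ^^ k) x) p"
proof -
  have p: "0 < p" "(f ^^ p) x = x" using assms by (auto simp: has_smallest_period_def)
  have return: "(f ^^ (k * p - k)) ((f ^^ k) x) = x"
  proof -
    have "(f ^^ (p * k)) x = x"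
      by (induction k) (simp_all add: funpow_add p)
    moreover have "k \<le> k * p" using p by simp
    ultimately show ?thesis by (simp flip: funpow_add[THEN fun_cong, unfolded o_apply] add: mult.commute)
  qed
  have comm: "(f ^^ i) ((f ^^ j) y) = (f ^^ j) ((f ^^ i) y)" for i j y
    by (simp flip: funpow_add[THEN fun_cong, unfolded o_apply] add: add.commute)
  have "(f ^^ j) x = x" if "(f ^^ j) ((f ^^ k) x) = (f ^^ k) x" for j
    using return comm that by metis
  moreover have "(f ^^ p) ((f ^^ k) x) = (f ^^ k) x"
    using comm[of p k x] p(2) by simp
  ultimately show ?thesis
    using assms unfolding has_smallest_period_def by blast
qed

lemma mod_3_eq_2E:
  assumes "(n :: nat) mod 3 = 2"
  obtains q where "n = 3 * q + 2"
  using assms by (metis mult_div_mod_eq)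

text \<open>
  Both parts differ from \<open>N\<close> by multiples of 3. If both were smaller than \<open>N\<close>, then for \<open>N = n + 3\<close>
  their sum would be too small, and for \<open>N = n + 6\<close> both would have to equal \<open>n + 3\<close>.
\<close>
lemma unequal_split_large_part:
  fixes n N l l' :: nat
  assumes "n mod 3 = 2" "N = n + 3 \<or> N = n + 6" "l + l' = n + N"
    and "l mod 3 = 2" "l' mod 3 = 2" "l \<noteq> l'"
  shows "N \<le> l \<or> N \<le> l'"
proof -
  obtain q k k' where split: "n = 3 * q + 2" "l = 3 * k + 2" "l' = 3 * k' + 2"
    using assms(1,4,5) by (elim mod_3_eq_2E)
  from assms(2) show ?thesis
  proof
    assume N: "N = n + 3"
    then have "q + 1 \<le> k \<or> q + 1 \<le> k'" using assms(3) split by linarith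
    then show ?thesis using N split by auto
  next
    assume N: "N = n + 6"
    then have "k + k' = 2 * q + 2" using assms(3) split by simp
    moreover have "k \<noteq> k'" using assms(6) split by simp
    ultimately have "q + 2 \<le> k \<or> q + 2 \<le> k'" by linarith
    then show ?thesis using N split by auto
  qed
qed

section \<open>The map in adapted coordinates\<close>

locale tribonacci_base =
  fixes \<beta> :: real
  assumes gt_1: "1 < \<beta>" and lt_2: "\<beta> < 2" and cubic: "\<beta> ^ 3 = \<beta> ^ 2 + \<beta> + 1"
begin

abbreviation T :: "real \<Rightarrow> real" where "T \<equiv> beta_map \<beta>"

text \<open>
  The origin of the coordinate is \<open>1/\<beta>\<close>, the value of the expansion 011011011... and the fixed point
  of \<open>x \<mapsto> \<beta>\<^sup>3 x - \<beta> - 1\<close>, which is three steps of the map with digits 011; the scale makes \<open>P 1 = 1/\<beta>\<^sup>2 + 1/\<beta>\<^sup>3\<close> the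
  boundary between the points that start with 010 and those that start with 011.
\<close>
definition P :: "real \<Rightarrow> real" where "P s = 1 / \<beta> - s / \<beta> ^ 4"

lemma pos: "0 < \<beta>" using gt_1 by simp

lemma inverse_power_identities:
  shows "1 / \<beta> ^ 2 = \<beta> - 1 - 1 / \<beta>"
    and "1 / \<beta> ^ 3 = 1 - 1 / \<beta> - 1 / \<beta> ^ 2"
    and "1 / \<beta> ^ 4 = 1 / \<beta> - 1 / \<beta> ^ 2 - 1 / \<beta> ^ 3"
proof -
  show 2: "1 / \<beta> ^ 2 = \<beta> - 1 - 1 / \<beta>"
    using pos cubic by (simp add: field_simps eval_nat_numeral)
  have "1 / \<beta> ^ 3 = 1 / \<beta> ^ 2 * (1 / \<beta>)"
    by (simp add: eval_nat_numeral)
  also have "\<dots> = 1 - 1 / \<beta> - 1 / \<beta> ^ 2"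
    using pos by (subst 2) (simp add: diff_divide_distrib power2_eq_square)
  finally show 3: "1 / \<beta> ^ 3 = 1 - 1 / \<beta> - 1 / \<beta> ^ 2" .
  have "1 / \<beta> ^ 4 = 1 / \<beta> ^ 3 * (1 / \<beta>)"
    by (simp add: eval_nat_numeral)
  also have "\<dots> = 1 / \<beta> - 1 / \<beta> ^ 2 - 1 / \<beta> ^ 3"
    by (subst 3) (simp add: diff_divide_distrib eval_nat_numeral)
  finally show "1 / \<beta> ^ 4 = 1 / \<beta> - 1 / \<beta> ^ 2 - 1 / \<beta> ^ 3" .
qed

lemma P_less_iff [simp]: "P s < P s' \<longleftrightarrow> s' < s"
  using pos by (simp add: P_def divide_less_cancel)

lemma P_le_iff [simp]: "P s \<le> P s' \<longleftrightarrow> s' \<le> s"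
  using pos by (simp add: P_def divide_le_cancel)

lemma P_surj: "\<exists>s. y = P s"
  using pos by (intro exI[of _ "\<beta> ^ 4 * (1 / \<beta> - y)"]) (simp add: P_def)

lemma P_0: "P 0 = 1 / \<beta>"
  by (simp add: P_def)

text \<open>Points below \<open>1/\<beta>\<^sup>2\<close> are those whose first two digits are 00.\<close>
lemma P_1_plus_base: "P (1 + \<beta>) = 1 / \<beta> ^ 2"
proof -
  have "(1 + \<beta>) / \<beta> ^ 4 = 1 / \<beta> ^ 4 + 1 / \<beta> ^ 3"
    using pos by (simp add: field_simps eval_nat_numeral)
  then show ?thesis
    using inverse_power_identities by (simp add: P_def)
qed

lemma T_digit_0: "0 \<le> x \<Longrightarrow> x < 1 / \<beta> \<Longrightarrow> T x = \<beta> * x"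
  using pos by (simp add: beta_map_def frac_eq field_simps)

lemma T_digit_1: "1 / \<beta> \<le> x \<Longrightarrow> x < 1 \<Longrightarrow> T x = \<beta> * x - 1"
proof -
  assume x: "1 / \<beta> \<le> x" "x < 1"
  have "\<beta> * x < \<beta> * 1"
    using x pos by (intro mult_strict_left_mono) auto
  then have "\<beta> * x < 2" using lt_2 by simp
  moreover have "1 \<le> \<beta> * x" using x pos by (simp add: field_simps)
  ultimately show ?thesis
    unfolding beta_map_def by (auto simp: frac_unique_iff)
qed

lemma T_bounds: "0 \<le> T x" "T x < 1"
  by (auto simp: beta_map_def frac_lt_1)

lemma T_P:
  assumes "0 < s" "s \<le> 1 + \<beta>"
  shows "T (P s) = 1 - s / \<beta> ^ 3"
proof -
  have "P (1 + \<beta>) \<le> P s" "P s < P 0" using assms by simp_all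
  then have "T (P s) = \<beta> * P s"
    using pos by (intro T_digit_0) (auto simp: P_1_plus_base P_0 intro: order_trans[rotated])
  also have "\<dots> = 1 - s / \<beta> ^ 3"
    using pos by (simp add: P_def field_simps eval_nat_numeral)
  finally show ?thesis .
qed

lemma T_P_ge:
  assumes "s \<le> 1 + \<beta>"
  shows "1 / \<beta> \<le> 1 - s / \<beta> ^ 3"
proof -
  have "s / \<beta> ^ 3 \<le> (1 + \<beta>) / \<beta> ^ 3"
    using assms pos by (intro divide_right_mono) auto
  also have "\<dots> = 1 / \<beta> ^ 3 + 1 / \<beta> ^ 2"
    using pos by (simp add: field_simps eval_nat_numeral)
  finally show ?thesis using inverse_power_identities(2) by linarith
qed

text \<open>
  The digits 01 are read here. The third digit is 1 exactly when \<open>s \<le> 1\<close>, since then the image is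
  at least \<open>P 0 = 1/\<beta>\<close>.
\<close>
lemma T_T_P:
  assumes "0 < s" "s \<le> 1 + \<beta>"
  shows "T (T (P s)) = P (\<beta> ^ 2 * (s - 1))"
proof -
  have "T (1 - s / \<beta> ^ 3) = \<beta> * (1 - s / \<beta> ^ 3) - 1"
    using T_P_ge[OF assms(2)] assms pos by (intro T_digit_1) auto
  also have "\<dots> = 1 / \<beta> + 1 / \<beta> ^ 2 - s / \<beta> ^ 2"
    unfolding inverse_power_identities(1) using pos by (simp add: field_simps eval_nat_numeral)
  also have "\<dots> = P (\<beta> ^ 2 * (s - 1))"
    using pos by (simp add: P_def field_simps eval_nat_numeral)
  finally show ?thesis using T_P[OF assms] by simp
qed

text \<open>The digits 011 are read: \<open>s \<le> 1\<close> makes the third digit 1.\<close>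
lemma T_T_T_P:
  assumes "0 < s" "s \<le> 1"
  shows "T (T (T (P s))) = P (\<beta> ^ 3 * s)"
proof -
  let ?x = "P (\<beta> ^ 2 * (s - 1))"
  have TT: "T (T (P s)) = ?x"
    using assms pos by (intro T_T_P) auto
  have "P 0 \<le> ?x"
    using assms by (simp add: mult_nonneg_nonpos)
  moreover have "?x < 1"
    using T_bounds(2)[of "T (P s)"] TT by simp
  ultimately have "T ?x = \<beta> * ?x - 1"
    by (intro T_digit_1) (auto simp: P_0)
  also have "\<beta> * ?x = 1 - s / \<beta> + 1 / \<beta>"
    using pos by (simp add: P_def field_simps eval_nat_numeral)
  also have "\<dots> - 1 = P (\<beta> ^ 3 * s)"
    using pos by (simp add: P_def field_simps eval_nat_numeral)
  finally show ?thesis using TT by simp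
qed

section \<open>First returns to the points that start with 010\<close>

text \<open>
  The orbit reads 01 and then \<open>r\<close> blocks 011; the hypothesis on \<open>j < r\<close> says that after each of the
  first blocks the point has not yet come back below \<open>P 1\<close>. The intermediate points inside a block
  start with 10, 11 or 011 and are therefore above \<open>P 1\<close> as well.
\<close>
lemma return_orbit:
  assumes "1 < s" "s \<le> 1 + \<beta>" and "\<forall>j<r. \<beta> ^ (3 * j + 2) * (s - 1) \<le> 1"
  shows "(T ^^ (3 * r + 2)) (P s) = P (\<beta> ^ (3 * r + 2) * (s - 1)) \<and>
    (\<forall>i. 0 < i \<and> i < 3 * r + 2 \<longrightarrow> P 1 \<le> (T ^^ i) (P s))"
  using assms(3)
proof (induction r)
  case 0
  have "T (P s) = 1 - s / \<beta> ^ 3" using T_P assms by simp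
  moreover have "P 1 < P 0" by simp
  ultimately have "P 1 \<le> T (P s)"
    using T_P_ge[OF assms(2)] by (simp add: P_0)
  then have "P 1 \<le> (T ^^ i) (P s)" if "0 < i" "i < 2" for i
  proof -
    have "i = 1" using that by linarith
    then show ?thesis using \<open>P 1 \<le> T (P s)\<close> by simp
  qed
  then show ?case
    using T_T_P[of s] assms by (simp add: numeral_2_eq_2)
next
  case (Suc r)
  define w where "w = \<beta> ^ (3 * r + 2) * (s - 1)"
  have w: "0 < w" "w \<le> 1"
    using Suc.prems assms pos by (auto simp: w_def)
  have IH: "(T ^^ (3 * r + 2)) (P s) = P w"
    "\<And>i. 0 < i \<Longrightarrow> i < 3 * r + 2 \<Longrightarrow> P 1 \<le> (T ^^ i) (P s)"
    using Suc.IH Suc.prems by (auto simp: w_def)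
  have later: "(T ^^ (k + (3 * r + 2))) (P s) = (T ^^ k) (P w)" for k
    unfolding funpow_add[of k] o_apply IH(1) ..
  have "(T ^^ (3 * Suc r + 2)) (P s) = (T ^^ 3) (P w)"
    using later[of 3] by (simp add: algebra_simps del: funpow.simps)
  also have "\<dots> = P (\<beta> ^ 3 * w)"
    using T_T_T_P[OF w] by (simp add: eval_nat_numeral)
  also have "\<beta> ^ 3 * w = \<beta> ^ (3 * Suc r + 2) * (s - 1)"
    by (simp add: w_def power_add eval_nat_numeral)
  finally have 1: "(T ^^ (3 * Suc r + 2)) (P s) = P (\<beta> ^ (3 * Suc r + 2) * (s - 1))" .
  have P10: "P 1 < P 0" by simp
  have 2: "P 1 \<le> (T ^^ i) (P s)" if i: "0 < i" "i < 3 * Suc r + 2" for i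
  proof (cases "i < 3 * r + 2")
    case False
    define k where "k = i - (3 * r + 2)"
    have k: "i = k + (3 * r + 2)" "k = 0 \<or> k = 1 \<or> k = 2"
      using False i by (auto simp: k_def)
    have "P 1 \<le> P w" using w by simp
    moreover have "P 1 \<le> T (P w)"
      using T_P[of w] T_P_ge[of w] w pos P10 by (simp add: P_0)
    moreover have "\<beta> ^ 2 * (w - 1) \<le> 0"
      using w by (intro mult_nonneg_nonpos) auto
    then have "P 1 \<le> T (T (P w))"
      using w pos T_T_P[of w] by simp
    ultimately show ?thesis
      using k(2) unfolding k(1) later by (auto simp: eval_nat_numeral)
  qed (use IH(2) i in auto)
  show ?case using 1 2 by blast
qed

lemma power_unbounded: "0 < v \<Longrightarrow> \<exists>r. K < \<beta> ^ (3 * r + 2) * v"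
proof -
  assume v: "0 < v"
  obtain r where r: "K / v < \<beta> ^ r" using real_arch_pow[OF gt_1] by blast
  also have "\<beta> ^ r \<le> \<beta> ^ (3 * r + 2)" using gt_1 by (intro power_increasing) auto
  finally show ?thesis using v by (auto simp: field_simps)
qed

lemma first_return:
  assumes "1 < s" "s \<le> 1 + \<beta>"
  obtains l where "l mod 3 = 2" "1 < \<beta> ^ l * (s - 1)"
    "(T ^^ l) (P s) = P (\<beta> ^ l * (s - 1))"
    "\<And>i. 0 < i \<Longrightarrow> i < l \<Longrightarrow> P 1 \<le> (T ^^ i) (P s)"
proof -
  define r where "r = (LEAST r. 1 < \<beta> ^ (3 * r + 2) * (s - 1))"
  have "1 < \<beta> ^ (3 * r + 2) * (s - 1)"
    unfolding r_def by (rule LeastI_ex) (use power_unbounded[of "s - 1" 1] assms in auto)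
  moreover have "\<forall>j<r. \<beta> ^ (3 * j + 2) * (s - 1) \<le> 1"
    unfolding r_def by (meson not_less not_less_Least)
  moreover have "(3 * r + 2) mod 3 = 2" by presburger
  ultimately show thesis
    using return_orbit[OF assms, of r] by (intro that[of "3 * r + 2"]) blast+
qed

text \<open>
  An orbit without 00 that avoids 010 can only repeat 011 forever once it has read a digit 0. But a
  block 011 multiplies the distance to \<open>1/\<beta>\<close> by \<open>\<beta>\<^sup>3\<close>, so this cannot go on.
\<close>
lemma reaches_below_P_1:
  assumes orbit: "\<And>k. P (1 + \<beta>) \<le> (T ^^ k) x" "\<And>k. (T ^^ k) x < 1"
  shows "\<exists>k. (T ^^ k) x < P 1"
proof (rule ccontr)
  assume "\<not> ?thesis"
  then have ge: "P 1 \<le> (T ^^ k) x" for k by (auto simp: not_less)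
  \<comment> \<open>A digit 0 occurs among the first three, since 111 would give \<open>x \<ge> 1\<close>.\<close>
  have "\<exists>k. (T ^^ k) x < P 0"
  proof (rule ccontr)
    assume "\<not> ?thesis"
    then have "1 / \<beta> \<le> (T ^^ k) x" for k by (auto simp: not_less P_0)
    then have "T ((T ^^ k) x) = \<beta> * (T ^^ k) x - 1" for k
      using orbit(2) by (intro T_digit_1) auto
    from this[of 0] this[of 1] this[of 2]
    have step: "T x = \<beta> * x - 1" "T (T x) = \<beta> * T x - 1" "T (T (T x)) = \<beta> * T (T x) - 1"
      by (simp_all add: numeral_2_eq_2)
    have "(T ^^ 3) x = T (T (T x))"
      by (simp add: numeral_3_eq_3)
    also have "\<dots> = \<beta> * (\<beta> * (\<beta> * x - 1) - 1) - 1"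
      by (subst step(3), subst step(2), subst step(1)) (rule refl)
    also have "\<dots> = \<beta> ^ 3 * x - \<beta> ^ 2 - \<beta> - 1"
      by (simp add: eval_nat_numeral algebra_simps)
    also have "\<dots> = \<beta> ^ 3 * (x - 1)" using cubic by (simp add: algebra_simps)
    also have "\<dots> < 0" using orbit(2)[of 0] pos by (simp add: mult_pos_neg)
    finally have "(T ^^ 3) x < 0" .
    moreover have "0 \<le> (T ^^ 3) x" using T_bounds(1) by (simp add: eval_nat_numeral)
    ultimately show False by simp
  qed
  then obtain k s where k: "(T ^^ k) x = P s" "(T ^^ k) x < P 0" using P_surj by metis
  then have s: "0 < s" by simp
  have "(T ^^ (3 * j + k)) x = P (\<beta> ^ (3 * j) * s)" for j
  proof (induction j)
    case (Suc j)
    let ?s = "\<beta> ^ (3 * j) * s"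
    have "P 1 \<le> P ?s" using ge[of "3 * j + k"] Suc by simp
    then have "?s \<le> 1" by simp
    then have "T (T (T (P ?s))) = P (\<beta> ^ 3 * ?s)"
      using s pos by (intro T_T_T_P) auto
    then show ?case using Suc
      by (simp add: eval_nat_numeral algebra_simps)
  qed (simp add: k)
  then have "\<beta> ^ (3 * j) * s \<le> 1" for j
    using ge[of "3 * j + k"] by simp
  then have bounded: "\<not> 1 < \<beta> ^ (3 * j) * s" for j by (simp add: not_less)
  obtain r where "1 < \<beta> ^ (3 * r + 2) * (s / \<beta> ^ 2)"
    using power_unbounded[of "s / \<beta> ^ 2" 1] s pos by auto
  moreover have "\<beta> ^ (3 * r + 2) * (s / \<beta> ^ 2) = \<beta> ^ (3 * r) * s"
    using pos by (simp add: power_add power2_eq_square)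
  ultimately have "1 < \<beta> ^ (3 * r) * s" by simp
  then show False using bounded by blast
qed

section \<open>The point with two returns\<close>

text \<open>The solution \<open>v\<close> of \<open>\<beta>\<^sup>N (\<beta>\<^sup>n v - 1) - 1 = v\<close>.\<close>
definition \<phi> :: "nat \<Rightarrow> nat \<Rightarrow> real" where
  "\<phi> n N = (\<beta> ^ N + 1) / (\<beta> ^ (n + N) - 1)"

lemma phi_pos: "0 < n \<Longrightarrow> 0 < \<phi> n N"
  unfolding \<phi>_def using gt_1 pos by (intro divide_pos_pos add_pos_pos) auto

text \<open>
  A return of length \<open>n\<close> moves \<open>\<phi> n N\<close> to \<open>\<phi> N n\<close>, exchanging the two lengths.
\<close>
lemma phi_step: "0 < n \<Longrightarrow> \<beta> ^ n * \<phi> n N = 1 + \<phi> N n"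
proof -
  assume "0 < n"
  then have "1 < \<beta> ^ (n + N)" using gt_1 by (intro one_less_power) auto
  then have "1 + (\<beta> ^ n + 1) / (\<beta> ^ (n + N) - 1) = (\<beta> ^ (n + N) + \<beta> ^ n) / (\<beta> ^ (n + N) - 1)"
    by (simp add: add_divide_eq_iff)
  also have "\<beta> ^ (n + N) + \<beta> ^ n = \<beta> ^ n * (\<beta> ^ N + 1)"
    by (simp add: power_add distrib_left)
  finally show ?thesis
    unfolding \<phi>_def add.commute[of N n] by simp
qed

lemma cubic_gt: "3 < \<beta> ^ 3"
proof -
  have "1 < \<beta> ^ 2" using gt_1 by (intro one_less_power) auto
  then show ?thesis using gt_1 cubic by linarith
qed

text \<open>
  A return from \<open>\<phi> n N\<close>, or from any smaller value, cannot happen at time \<open>n - 3\<close> or earlier. As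
  return times are congruent modulo 3, this excludes all candidates below \<open>n\<close>.
\<close>
lemma phi_power_le_1:
  assumes "l + 3 \<le> n"
  shows "\<beta> ^ l * \<phi> n N \<le> 1"
proof -
  have "\<beta> ^ l * \<beta> ^ N * 3 \<le> \<beta> ^ l * \<beta> ^ N * \<beta> ^ 3"
    using cubic_gt pos by (intro mult_left_mono) auto
  also have "\<dots> = \<beta> ^ (l + 3 + N)" by (simp add: power_add)
  also have "\<dots> \<le> \<beta> ^ (n + N)"
    using assms gt_1 by (intro power_increasing) auto
  finally have 1: "\<beta> ^ l * \<beta> ^ N * 3 \<le> \<beta> ^ (n + N)" .
  have 2: "1 \<le> \<beta> ^ l" "1 \<le> \<beta> ^ N" using gt_1 by auto
  then have "\<beta> ^ l * 1 \<le> \<beta> ^ l * \<beta> ^ N" by (intro mult_left_mono) auto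
  then have "\<beta> ^ l * (\<beta> ^ N + 1) \<le> \<beta> ^ (n + N) - 1"
    using 1 2 unfolding distrib_left by linarith
  moreover have "1 < \<beta> ^ (n + N)" using assms gt_1 by (intro one_less_power) auto
  ultimately show ?thesis
    by (simp add: \<phi>_def divide_le_eq)
qed

text \<open>This bound says that \<open>P (1 + \<phi> n N)\<close> does not start with 00.\<close>
lemma phi_le_base:
  assumes "2 \<le> n" "1 \<le> N"
  shows "\<phi> n N \<le> \<beta>"
proof -
  have N: "\<beta> \<le> \<beta> ^ N"
    using gt_1 assms power_increasing[of 1 N \<beta>] by simp
  have "\<beta> ^ N * 3 \<le> \<beta> ^ N * \<beta> ^ 3"
    using cubic_gt pos by (intro mult_left_mono) auto
  also have "\<dots> = \<beta> ^ (3 + N)" by (simp add: power_add)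
  also have "\<dots> \<le> \<beta> ^ Suc (n + N)" using assms gt_1 by (intro power_increasing) auto
  finally have "\<beta> ^ N + 1 \<le> \<beta> * (\<beta> ^ (n + N) - 1)"
    using N gt_1 by (simp add: algebra_simps)
  moreover have "1 < \<beta> ^ (n + N)" using assms gt_1 by (intro one_less_power) auto
  ultimately show ?thesis by (simp add: \<phi>_def divide_le_eq)
qed

lemma phi_less_left:
  assumes "0 < n" "n < n'"
  shows "\<phi> n' N < \<phi> n N"
proof -
  have "1 < \<beta> ^ (n + N)" using assms gt_1 by (intro one_less_power) auto
  moreover have "\<beta> ^ (n + N) < \<beta> ^ (n' + N)"
    using assms gt_1 by (intro power_strict_increasing) auto
  ultimately show ?thesis
    unfolding \<phi>_def using pos by (intro divide_strict_left_mono mult_pos_pos add_pos_pos) auto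
qed

text \<open>
  The numerator depends on \<open>N\<close> as well; applying one return exchanges the arguments and reduces the
  claim to the monotonicity in the first one.
\<close>
lemma phi_less_right:
  assumes "0 < n" "0 < N" "N < N'"
  shows "\<phi> n N' < \<phi> n N"
proof -
  have "\<beta> ^ n * \<phi> n N' < \<beta> ^ n * \<phi> n N"
    using phi_less_left[of N N' n] assms by (simp add: phi_step)
  then show ?thesis using pos by (simp add: mult_less_cancel_left_pos)
qed

text \<open>As \<open>\<beta>\<^sup>n \<phi> n N = 1 + \<phi> N n \<le> 1 + \<beta>\<close>, the decay is geometric in \<open>n\<close>, whatever \<open>N\<close> does.\<close>
lemma phi_tendsto_0:
  assumes "filterlim n at_top F" "eventually (\<lambda>m. 2 \<le> n m \<and> 2 \<le> N m) F"
  shows "((\<lambda>m. \<phi> (n m) (N m)) \<longlongrightarrow> 0) F"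
proof (rule tendsto_sandwich[where f = "\<lambda>_. 0" and h = "\<lambda>m. (1 + \<beta>) * (1 / \<beta>) ^ n m"])
  have "((\<lambda>k. (1 + \<beta>) * (1 / \<beta>) ^ k) \<longlongrightarrow> (1 + \<beta>) * 0) sequentially"
    using gt_1 by (intro tendsto_intros LIMSEQ_power_zero) auto
  then show "((\<lambda>m. (1 + \<beta>) * (1 / \<beta>) ^ n m) \<longlongrightarrow> 0) F"
    using filterlim_compose[OF _ assms(1)] by auto
  show "eventually (\<lambda>m. 0 \<le> \<phi> (n m) (N m)) F"
    using assms(2) by eventually_elim (intro less_imp_le phi_pos, simp)
  show "eventually (\<lambda>m. \<phi> (n m) (N m) \<le> (1 + \<beta>) * (1 / \<beta>) ^ n m) F"
    using assms(2)
  proof eventually_elim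
    case (elim m)
    then have "\<beta> ^ n m * \<phi> (n m) (N m) \<le> 1 + \<beta>"
      using phi_le_base[of "N m" "n m"] by (simp add: phi_step)
    then show ?case using pos by (simp add: field_simps)
  qed
qed auto

section \<open>The supremum for a given period\<close>

text \<open>
  Suppose the whole orbit lies above \<open>P (1 + \<phi> n N)\<close>. Then it avoids 00, it visits the points that
  start with 010, and all coordinates \<open>v\<close> of these visits are below \<open>\<phi> n N\<close>. Hence every return
  takes at least time \<open>n\<close> and any two consecutive ones at least \<open>2 n + 3\<close>. The period, congruent to 1
  modulo 3, is a sum of return times, each congruent to 2; one or three of them have the wrong residue
  and four are too long. So the period consists of two returns. They differ in length, as the
  period is smallest, and the longer has length at least \<open>N\<close>, which makes one \<open>v\<close> too large.
\<close>
lemma orbit_reaches_word: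
  assumes nN: "n mod 3 = 2" "N = n + 3 \<or> N = n + 6"
    and period: "has_smallest_period T x (n + N)" and x: "x \<in> {0..<1}"
  shows "\<exists>k. (T ^^ k) x \<le> P (1 + \<phi> n N)"
proof (rule ccontr)
  assume "\<not> ?thesis"
  then have above: "P (1 + \<phi> n N) < (T ^^ k) x" for k by (auto simp: not_le)
  have n2: "2 \<le> n" "2 \<le> N" using nN by (auto elim: mod_3_eq_2E)
  have orbit: "P (1 + \<beta>) \<le> (T ^^ k) x" "(T ^^ k) x < 1" for k
  proof -
    have "P (1 + \<beta>) \<le> P (1 + \<phi> n N)" using phi_le_base[of n N] n2 by simp
    then show "P (1 + \<beta>) \<le> (T ^^ k) x" using above[of k] by linarith
    show "(T ^^ k) x < 1" using x T_bounds(2) by (cases k) auto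
  qed
  have return: "\<exists>l v'. l mod 3 = 2 \<and> v' = \<beta> ^ l * v - 1 \<and> 0 < v' \<and> v' < \<phi> n N \<and> n \<le> l \<and>
      (T ^^ (l + k)) x = P (1 + v') \<and> (\<forall>i. 0 < i \<and> i < l \<longrightarrow> P 1 \<le> (T ^^ (i + k)) x)"
    if k: "(T ^^ k) x = P (1 + v)" and v: "0 < v" for k v
  proof -
    have "v \<le> \<beta>" using orbit(1)[of k] by (simp add: k)
    then obtain l where l: "l mod 3 = 2" "1 < \<beta> ^ l * v"
      "(T ^^ l) (P (1 + v)) = P (\<beta> ^ l * v)"
      "\<And>i. 0 < i \<Longrightarrow> i < l \<Longrightarrow> P 1 \<le> (T ^^ i) (P (1 + v))"
      using first_return[of "1 + v"] v by auto
    have next_point: "(T ^^ (l + k)) x = P (1 + (\<beta> ^ l * v - 1))"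
      using l(3) by (simp add: funpow_add k)
    have "v < \<phi> n N" using above[of k] by (simp add: k)
    have "n \<le> l"
    proof (rule ccontr)
      assume "\<not> n \<le> l"
      then have "l + 3 \<le> n" using l(1) nN(1) by presburger
      then have "\<beta> ^ l * \<phi> n N \<le> 1" by (rule phi_power_le_1)
      moreover have "\<beta> ^ l * v < \<beta> ^ l * \<phi> n N"
        using \<open>v < \<phi> n N\<close> pos by simp
      ultimately show False using l(2) by linarith
    qed
    moreover have "\<beta> ^ l * v - 1 < \<phi> n N"
      using above[of "l + k"] unfolding next_point by simp
    ultimately show ?thesis
      using l next_point by (intro exI[of _ l]) (auto simp: funpow_add k)
  qed
  \<comment> \<open>Two returns of length \<open>n\<close> in a row would start at \<open>v < \<phi> n N\<close>, pass through a value below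
    \<open>\<phi> N n\<close>, and come back from there too early, because \<open>n \<le> N - 3\<close>.\<close>
  have two_returns: "2 * n + 3 \<le> l + l'"
    if "l mod 3 = 2" "l' mod 3 = 2" "n \<le> l" "n \<le> l'" "v < \<phi> n N" "0 < \<beta> ^ l' * (\<beta> ^ l * v - 1) - 1"
    for l l' v
  proof (rule ccontr)
    assume "\<not> ?thesis"
    then have "l < n + 3" "l' < n + 3" using that(3,4) by linarith+
    moreover have "l = n" if "l < n + 3" "n \<le> l" "l mod 3 = 2" for l
      using that nN(1) by presburger
    ultimately have l: "l = n" "l' = n" using that(1-4) by blast+
    have "\<beta> ^ n * v < \<beta> ^ n * \<phi> n N" using that(5) pos by simp
    then have "\<beta> ^ n * v - 1 < \<phi> N n" using phi_step n2 by simp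
    then have "\<beta> ^ n * (\<beta> ^ n * v - 1) < \<beta> ^ n * \<phi> N n" using pos by simp
    also have "\<dots> \<le> 1" using nN(2) by (intro phi_power_le_1) auto
    finally show False using that(6) l by simp
  qed
  obtain k where "(T ^^ k) x < P 1" using reaches_below_P_1 orbit by blast
  then obtain s where "(T ^^ k) x = P s" "1 < s" using P_surj by (metis P_less_iff)
  then obtain v0 where v0: "(T ^^ k) x = P (1 + v0)" "0 < v0"
    by (metis add_diff_cancel_left' diff_gt_0_iff_gt add.commute diff_add_cancel)
  have v0_less: "v0 < \<phi> n N" using above[of k] by (simp add: v0)
  define p where "p = n + N"
  have p: "p mod 3 = 1"
    using nN unfolding p_def by (elim disjE mod_3_eq_2E) (simp_all, presburger+)
  have p_le: "p \<le> 2 * n + 6" using nN(2) unfolding p_def by linarith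
  obtain l1 v1 where 1: "l1 mod 3 = 2" "v1 = \<beta> ^ l1 * v0 - 1" "0 < v1" "v1 < \<phi> n N" "n \<le> l1"
      "(T ^^ (l1 + k)) x = P (1 + v1)" "\<And>i. 0 < i \<Longrightarrow> i < l1 \<Longrightarrow> P 1 \<le> (T ^^ (i + k)) x"
    using return[OF v0] by blast
  obtain l2 v2 where 2: "l2 mod 3 = 2" "v2 = \<beta> ^ l2 * v1 - 1" "0 < v2" "v2 < \<phi> n N" "n \<le> l2"
      "(T ^^ (l2 + (l1 + k))) x = P (1 + v2)"
      "\<And>i. 0 < i \<Longrightarrow> i < l2 \<Longrightarrow> P 1 \<le> (T ^^ (i + (l1 + k))) x"
    using return[OF 1(6,3)] by blast
  obtain l3 v3 where 3: "l3 mod 3 = 2" "v3 = \<beta> ^ l3 * v2 - 1" "0 < v3" "v3 < \<phi> n N" "n \<le> l3"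
      "(T ^^ (l3 + (l2 + (l1 + k)))) x = P (1 + v3)"
      "\<And>i. 0 < i \<Longrightarrow> i < l3 \<Longrightarrow> P 1 \<le> (T ^^ (i + (l2 + (l1 + k)))) x"
    using return[OF 2(6,3)] by blast
  obtain l4 v4 where 4: "l4 mod 3 = 2" "v4 = \<beta> ^ l4 * v3 - 1" "0 < v4" "n \<le> l4"
      "\<And>i. 0 < i \<Longrightarrow> i < l4 \<Longrightarrow> P 1 \<le> (T ^^ (i + (l3 + (l2 + (l1 + k))))) x"
    using return[OF 3(6,3)] by blast
  have per: "(T ^^ (p + k)) x = P (1 + v0)" "\<And>j. 0 < j \<Longrightarrow> j < p \<Longrightarrow> (T ^^ (j + k)) x \<noteq> P (1 + v0)"
    using has_smallest_period_shift[OF period, of k]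
    by (auto simp: p_def has_smallest_period_def v0(1)[symmetric] funpow_add)
  have not_P1: "\<not> P 1 \<le> (T ^^ (p + k)) x" using per(1) v0(2) by simp
  \<comment> \<open>Time \<open>p\<close> brings the orbit back below \<open>P 1\<close>, so it is never strictly inside a return.\<close>
  have "l1 + l2 = p"
  proof -
    have "0 < p" using n2 p_def by simp
    then have "l1 \<le> p" using 1(7)[of p] not_P1 by (meson not_less)
    moreover have "l1 \<noteq> p" using p 1(1) by auto
    ultimately have "l1 < p" by simp
    then have "l1 + l2 \<le> p"
      using 2(7)[of "p - l1"] not_P1 by (cases "p - l1 < l2") (auto simp: not_less)
    moreover have False if "l1 + l2 < p"
    proof -
      have "l1 + l2 + l3 \<le> p"
        using 3(7)[of "p - (l1 + l2)"] not_P1 that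
        by (cases "p - (l1 + l2) < l3") (auto simp: not_less add.assoc[symmetric] add.commute[of l2 l1])
      moreover have "l1 + l2 + l3 \<noteq> p" using p 1(1) 2(1) 3(1) by (elim mod_3_eq_2E) (simp, presburger)
      ultimately have "l1 + l2 + l3 < p" by simp
      then have "l1 + l2 + l3 + l4 \<le> p"
        using 4(5)[of "p - (l1 + l2 + l3)"] not_P1
        by (cases "p - (l1 + l2 + l3) < l4") (auto simp: not_less add_ac)
      moreover have "2 * n + 3 \<le> l1 + l2"
        using two_returns[of l1 l2 v0] 1 2 v0_less by simp
      moreover have "2 * n + 3 \<le> l3 + l4"
        using two_returns[of l3 l4 v2] 2 3 4 by simp
      ultimately show False using p_le n2 by linarith
    qed
    ultimately show ?thesis by fastforce
  qed
  then have "(T ^^ (l2 + (l1 + k))) x = P (1 + v0)"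
    using per(1) by (simp add: add_ac)
  then have "v2 = v0" using 2(6) by (metis P_le_iff add_le_cancel_left order_antisym order_refl)
  have large: "1 < \<beta> ^ p" using n2 gt_1 unfolding p_def by (intro one_less_power) auto
  have v0_eq: "v0 = (\<beta> ^ l2 + 1) / (\<beta> ^ p - 1)" and v1_eq: "v1 = (\<beta> ^ l1 + 1) / (\<beta> ^ p - 1)"
  proof -
    have a: "\<beta> ^ l1 * v0 = 1 + v1" "\<beta> ^ l2 * v1 = 1 + v0"
      using 1(2) 2(2) \<open>v2 = v0\<close> by simp_all
    have "\<beta> ^ p * v0 = \<beta> ^ l2 * (\<beta> ^ l1 * v0)" "\<beta> ^ p * v1 = \<beta> ^ l1 * (\<beta> ^ l2 * v1)"
      by (simp_all add: \<open>l1 + l2 = p\<close>[symmetric] power_add)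
    then have "v0 * (\<beta> ^ p - 1) = \<beta> ^ l2 + 1" "v1 * (\<beta> ^ p - 1) = \<beta> ^ l1 + 1"
      unfolding a distrib_left mult_1_right by (simp_all add: algebra_simps)
    then show "v0 = (\<beta> ^ l2 + 1) / (\<beta> ^ p - 1)" "v1 = (\<beta> ^ l1 + 1) / (\<beta> ^ p - 1)"
      using large by (simp_all add: eq_divide_eq)
  qed
  have "l1 \<noteq> l2"
  proof
    assume "l1 = l2"
    then have "v1 = v0" using v0_eq v1_eq by simp
    moreover have "0 < l1" "l1 < p" using \<open>l1 + l2 = p\<close> \<open>l1 = l2\<close> p by auto
    ultimately show False using 1(6) per(2) by simp
  qed
  then have "N \<le> l1 \<or> N \<le> l2"
    using unequal_split_large_part[OF nN _ 1(1) 2(1)] \<open>l1 + l2 = p\<close> p_def by blast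
  moreover have "\<phi> n N \<le> (\<beta> ^ l + 1) / (\<beta> ^ p - 1)" if "N \<le> l" for l
    unfolding \<phi>_def p_def[symmetric] using large gt_1 that
    by (intro divide_right_mono add_right_mono power_increasing) auto
  ultimately show False using v0_eq v1_eq v0_less 1(4) by (metis not_less)
qed

text \<open>
  The point \<open>P (1 + \<phi> n N)\<close> has digits \<open>01(011)\<^sup>r\<close> with \<open>n = 3 r + 2\<close>, after which it moves to
  \<open>P (1 + \<phi> N n)\<close>.
\<close>
lemma word_orbit_half:
  assumes "n mod 3 = 2" "1 \<le> N"
  shows "(T ^^ n) (P (1 + \<phi> n N)) = P (1 + \<phi> N n)"
    and "\<And>i. 0 < i \<Longrightarrow> i < n \<Longrightarrow> P 1 \<le> (T ^^ i) (P (1 + \<phi> n N))"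
proof -
  obtain r where r: "n = 3 * r + 2" using assms(1) by (rule mod_3_eq_2E)
  have "\<beta> ^ (3 * j + 2) * \<phi> n N \<le> 1" if "j < r" for j
    using that r by (intro phi_power_le_1) auto
  moreover have "0 < \<phi> n N" "\<phi> n N \<le> \<beta>"
    using phi_pos phi_le_base r assms by auto
  ultimately have *: "(T ^^ n) (P (1 + \<phi> n N)) = P (\<beta> ^ n * \<phi> n N) \<and>
      (\<forall>i. 0 < i \<and> i < n \<longrightarrow> P 1 \<le> (T ^^ i) (P (1 + \<phi> n N)))"
    using return_orbit[of "1 + \<phi> n N" r] unfolding r by simp
  then show "(T ^^ n) (P (1 + \<phi> n N)) = P (1 + \<phi> N n)"
    using phi_step[of n N] r by simp
  show "\<And>i. 0 < i \<Longrightarrow> i < n \<Longrightarrow> P 1 \<le> (T ^^ i) (P (1 + \<phi> n N))"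
    using * by blast
qed

text \<open>
  The shorter return comes first; the intermediate point \<open>P (1 + \<phi> N n)\<close> is larger, as
  \<open>n < N\<close> gives \<open>\<phi> N n < \<phi> n N\<close>.
\<close>
lemma word_orbit:
  assumes "n mod 3 = 2" "N mod 3 = 2" "n < N"
  shows "(T ^^ (n + N)) (P (1 + \<phi> n N)) = P (1 + \<phi> n N)"
    and "\<And>i. 0 < i \<Longrightarrow> i < n + N \<Longrightarrow> P (1 + \<phi> n N) < (T ^^ i) (P (1 + \<phi> n N))"
proof -
  let ?y = "P (1 + \<phi> n N)"
  have n2: "2 \<le> n" using assms by (auto elim: mod_3_eq_2E)
  note first = word_orbit_half[of n N] and second = word_orbit_half[of N n]
  have later: "(T ^^ (k + n)) ?y = (T ^^ k) (P (1 + \<phi> N n))" for k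
    using first(1) assms by (simp add: funpow_add)
  show "(T ^^ (n + N)) ?y = ?y"
    using later[of N] second(1) assms n2 by (simp add: add.commute)
  have "1 < \<beta> ^ (n + N)" using n2 gt_1 by (intro one_less_power) auto
  moreover have "\<beta> ^ n < \<beta> ^ N" using assms gt_1 by simp
  ultimately have "\<phi> N n < \<phi> n N"
    unfolding \<phi>_def add.commute[of N n] by (intro divide_strict_right_mono) auto
  then have middle: "?y < P (1 + \<phi> N n)" by simp
  have "?y < P 1" using phi_pos[of n N] n2 by simp
  show "?y < (T ^^ i) ?y" if i: "0 < i" "i < n + N" for i
  proof (cases "i < n")
    case True
    then have "P 1 \<le> (T ^^ i) ?y" using first(2)[of i] i assms by auto
    with \<open>?y < P 1\<close> show ?thesis by (rule less_le_trans)
  next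
    case False
    then have "(T ^^ i) ?y = (T ^^ (i - n)) (P (1 + \<phi> N n))"
      using later[of "i - n"] by simp
    moreover have "?y < (T ^^ (i - n)) (P (1 + \<phi> N n))"
    proof (cases "i = n")
      case False
      then have "P 1 \<le> (T ^^ (i - n)) (P (1 + \<phi> N n))"
        using second(2)[of "i - n"] \<open>\<not> i < n\<close> i n2 assms by auto
      with \<open>?y < P 1\<close> show ?thesis by (rule less_le_trans)
    qed (simp add: middle del: P_less_iff)
    ultimately show ?thesis by simp
  qed
qed

text \<open>
  The difference \<open>N - n\<close> is 3 or 6, according to the parity of the number of blocks 011. It cannot
  be 0, for then the word would be a square and its period would be halved.
\<close>
theorem S_period_eq:
  assumes "n mod 3 = 2" "N = n + 3 \<or> N = n + 6"
  shows "S_period \<beta> (n + N) = P (1 + \<phi> n N)"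
  unfolding S_period_def
proof (rule cSup_eq_maximum)
  let ?y = "P (1 + \<phi> n N)"
  have nN: "n mod 3 = 2" "N mod 3 = 2" "n < N" "2 \<le> n" "2 \<le> N"
    using assms by (elim mod_3_eq_2E disjE; simp; presburger)+
  note orbit = word_orbit[OF nN(1-3)]
  have "P (1 + \<beta>) \<le> ?y" using phi_le_base[of n N] nN by simp
  then have "0 \<le> ?y" unfolding P_1_plus_base using pos by (auto intro: order_trans[rotated])
  moreover have "?y < 1" using orbit(2)[of 1] T_bounds(2)[of ?y] nN by simp
  moreover have ge: "?y \<le> (T ^^ i) ?y" for i
  proof -
    have "(T ^^ i) ?y = (T ^^ (i mod (n + N))) ?y"
      using funpow_mod_eq[OF orbit(1)] by metis
    moreover have "i mod (n + N) < n + N" using nN by simp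
    ultimately show ?thesis
      using orbit(2)[of "i mod (n + N)"] by (cases "i mod (n + N) = 0") auto
  qed
  moreover have "has_smallest_period T ?y (n + N)"
    unfolding has_smallest_period_def
    using orbit nN by (metis add_gr_0 less_irrefl less_le_trans less_numeral_extra(1) pos2)
  ultimately show "?y \<in> {t \<in> {0..<1}. \<exists>x \<in> survivor_set \<beta> t. has_smallest_period T x (n + N)}"
    by (auto simp: survivor_set_def)
  show "t \<le> ?y" if t: "t \<in> {t \<in> {0..<1}. \<exists>x \<in> survivor_set \<beta> t. has_smallest_period T x (n + N)}" for t
  proof -
    obtain x where x: "x \<in> survivor_set \<beta> t" "has_smallest_period T x (n + N)"
      using t by auto
    then obtain k where "(T ^^ k) x \<le> ?y"
      using orbit_reaches_word[OF assms, of x] by (auto simp: survivor_set_def)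
    moreover have "t \<le> (T ^^ k) x" using x(1) by (simp add: survivor_set_def)
    ultimately show ?thesis by simp
  qed
qed

section \<open>Closed form, monotonicity and limit\<close>

text \<open>
  The denominators \<open>\<beta>\<^sup>4\<close> and \<open>\<beta>\<^sup>3 - 1\<close> are exchanged with the help of the cubic equation. The
  exponent \<open>N = Suc M\<close> leaves \<open>N - 1\<close> free of truncated subtraction.
\<close>
lemma P_phi_formula:
  "P (1 + \<phi> n (Suc M)) =
    (1 + \<beta> + \<beta> ^ Suc M - \<beta> ^ M - \<beta> ^ (n + M) - \<beta> ^ (n + M + 2)) /
    ((1 - \<beta> ^ 3) * (\<beta> ^ (n + M + 1) - 1))"
proof -
  define a q where "a = \<beta> ^ M" and "q = \<beta> ^ (n + M)"
  have "1 < \<beta> ^ (n + M + 1)" using gt_1 by (intro one_less_power) auto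
  then have D: "\<beta> * q - 1 \<noteq> 0" by (simp add: q_def)
  have "P (1 + \<phi> n (Suc M)) = (\<beta> ^ 3 - 1 - (\<beta> * a + 1) / (\<beta> * q - 1)) / \<beta> ^ 4"
    using pos by (simp add: P_def \<phi>_def a_def q_def field_simps eval_nat_numeral)
  also have "\<dots> = ((\<beta> ^ 3 - 1) * (\<beta> * q - 1) - (\<beta> * a + 1)) / (\<beta> ^ 4 * (\<beta> * q - 1))"
    using D by (simp add: divide_simps) 
  also have "\<dots> = (1 + \<beta> + \<beta> * a - a - q - q * \<beta> ^ 2) / ((1 - \<beta> ^ 3) * (\<beta> * q - 1))"
  proof -
    have "((\<beta> ^ 3 - 1) * (\<beta> * q - 1) - (\<beta> * a + 1)) * (1 - \<beta> ^ 3)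
        = (1 + \<beta> + \<beta> * a - a - q - q * \<beta> ^ 2) * \<beta> ^ 4"
      using cubic by algebra
    moreover have "1 - \<beta> ^ 3 \<noteq> 0" using cubic_gt by simp
    ultimately show ?thesis
      using D pos
      by (subst frac_eq_eq) (simp_all only: mult_eq_0_iff power_not_zero, auto simp: mult_ac)
  qed
  finally show ?thesis
    by (simp add: a_def q_def power_add power2_eq_square mult_ac)
qed

text \<open>
  The two return lengths of the optimal word of length \<open>3 m + 1\<close>, meaningful for \<open>m \<ge> 2\<close>: the shorter
  block is \<open>01(011)\<^sup>r\<close> with \<open>r = m div 2 - 1\<close>.
\<close>
definition short_return :: "nat \<Rightarrow> nat" where "short_return m = 3 * (m div 2) - 1"

definition long_return :: "nat \<Rightarrow> nat" where "long_return m = 3 * m + 1 - short_return m"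

lemma returns_even: "short_return (2 * Suc w) = 3 * w + 2" "long_return (2 * Suc w) = 3 * w + 5"
  by (simp_all add: short_return_def long_return_def)

lemma returns_odd: "short_return (2 * Suc w + 1) = 3 * w + 2" "long_return (2 * Suc w + 1) = 3 * w + 8"
  by (simp_all add: short_return_def long_return_def)

lemma even_odd_ge_2E:
  assumes "2 \<le> m"
  obtains w where "m = 2 * Suc w" | w where "m = 2 * Suc w + 1"
proof -
  define w where "w = m div 2 - 1"
  have "m = 2 * Suc w \<or> m = 2 * Suc w + 1" using assms unfolding w_def by presburger
  then show thesis using that by blast
qed

lemma S_period_3m1:
  assumes "2 \<le> m"
  shows "S_period \<beta> (3 * m + 1) = P (1 + \<phi> (short_return m) (long_return m))"
  using assms
proof (cases rule: even_odd_ge_2E)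
  case (1 w)
  have "3 * m + 1 = (3 * w + 2) + (3 * w + 5)" using 1 by simp
  moreover have "(3 * w + 2) mod 3 = 2" by presburger
  ultimately show ?thesis
    using S_period_eq[of "3 * w + 2" "3 * w + 5"] 1 returns_even by simp
next
  case (2 w)
  have "3 * m + 1 = (3 * w + 2) + (3 * w + 8)" using 2 by simp
  moreover have "(3 * w + 2) mod 3 = 2" by presburger
  ultimately show ?thesis
    using S_period_eq[of "3 * w + 2" "3 * w + 8"] 2 returns_odd by simp
qed

lemma S_period_even:
  assumes "1 \<le> z"
  shows "S_period \<beta> (3 * (2 * z) + 1) =
    (1 + \<beta> + \<beta> ^ (3 * z + 2) - \<beta> ^ (3 * z + 1) - \<beta> ^ (6 * z) - \<beta> ^ (6 * z + 2)) /
    ((1 - \<beta> ^ 3) * (\<beta> ^ (6 * z + 1) - 1))"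
proof -
  obtain w where w: "z = Suc w" using assms by (cases z) auto
  have "S_period \<beta> (3 * (2 * z) + 1) = P (1 + \<phi> (3 * w + 2) (Suc (3 * w + 4)))"
    using S_period_3m1[of "2 * z"] unfolding w returns_even by (simp add: add.commute)
  moreover have "3 * w + 4 = 3 * z + 1" "Suc (3 * z + 1) = 3 * z + 2" "3 * w + 2 + (3 * z + 1) = 6 * z"
    using w by simp_all
  ultimately show ?thesis
    using P_phi_formula[of "3 * w + 2" "3 * w + 4"] by (simp only:)
qed

lemma S_period_odd:
  assumes "1 \<le> z"
  shows "S_period \<beta> (3 * (2 * z + 1) + 1) =
    (1 + \<beta> + \<beta> ^ (3 * z + 5) - \<beta> ^ (3 * z + 4) - \<beta> ^ (6 * z + 3) - \<beta> ^ (6 * z + 5)) /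
    ((1 - \<beta> ^ 3) * (\<beta> ^ (6 * z + 4) - 1))"
proof -
  obtain w where w: "z = Suc w" using assms by (cases z) auto
  have "S_period \<beta> (3 * (2 * z + 1) + 1) = P (1 + \<phi> (3 * w + 2) (Suc (3 * w + 7)))"
    using S_period_3m1[of "2 * z + 1"] unfolding w returns_odd by (simp add: add.commute)
  moreover have "3 * w + 7 = 3 * z + 4" "Suc (3 * z + 4) = 3 * z + 5" "3 * w + 2 + (3 * z + 4) = 6 * z + 3" "6 * z + 3 + 1 = 6 * z + 4" "6 * z + 3 + 2 = 6 * z + 5"
    using w by simp_all
  ultimately show ?thesis
    using P_phi_formula[of "3 * w + 2" "3 * w + 7"] by (simp only:)
qed

text \<open>
  From even to odd \<open>m\<close> only the longer return grows, from odd to even \<open>m\<close> only the shorter one;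
  in both steps \<open>\<phi>\<close> decreases.
\<close>
lemma S_period_strict_mono: "strict_mono_on {2..} (\<lambda>m. S_period \<beta> (3 * m + 1))"
proof -
  define S where "S = (\<lambda>m. S_period \<beta> (3 * m + 1))"
  have step: "S m < S (Suc m)" if "2 \<le> m" for m
    using that
  proof (cases rule: even_odd_ge_2E)
    case (1 w)
    have "\<phi> (short_return (Suc m)) (long_return (Suc m)) < \<phi> (short_return m) (long_return m)"
      using returns_even[of w] returns_odd[of w] phi_less_right 1 by simp
    then show ?thesis using that S_period_3m1[of m] S_period_3m1[of "Suc m"] by (simp add: S_def)
  next
    case (2 w)
    have "\<phi> (short_return (Suc m)) (long_return (Suc m)) < \<phi> (short_return m) (long_return m)"
      using returns_even[of "Suc w"] returns_odd[of w] phi_less_left 2 by (simp add: add.commute)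
    then show ?thesis using that S_period_3m1[of m] S_period_3m1[of "Suc m"] by (simp add: S_def)
  qed
  have "S m < S m'" if "2 \<le> m" "m < m'" for m m'
    using that(2,1)
  proof (induction rule: less_Suc_induct)
    case (1 i) then show ?case using step by simp
  next
    case (2 i j k) then show ?case by simp
  qed
  then show ?thesis by (auto simp: strict_mono_on_def S_def)
qed

lemma P_1: "P 1 = (\<beta> ^ 2 + 1) / (\<beta> ^ 4 - \<beta>)"
proof -
  have "\<beta> ^ 4 - \<beta> = \<beta> * (\<beta> ^ 3 - 1)" by (simp add: eval_nat_numeral algebra_simps)
  moreover have "\<beta> ^ 3 - 1 \<noteq> 0" using cubic_gt by simp
  moreover have "(\<beta> ^ 3 - 1) * (\<beta> * (\<beta> ^ 3 - 1)) = (\<beta> ^ 2 + 1) * \<beta> ^ 4"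
    using cubic by algebra
  moreover have "P 1 = (\<beta> ^ 3 - 1) / \<beta> ^ 4"
    using pos by (simp add: P_def field_simps eval_nat_numeral)
  ultimately show ?thesis using pos by (simp add: frac_eq_eq)
qed

lemma S_period_tendsto: "(\<lambda>m. S_period \<beta> (3 * m + 1)) \<longlonglongrightarrow> P 1"
proof -
  have "(\<lambda>m. \<phi> (short_return m) (long_return m)) \<longlonglongrightarrow> 0"
  proof (rule phi_tendsto_0)
    show "filterlim short_return at_top sequentially"
      unfolding filterlim_at_top
    proof
      fix K
      show "eventually (\<lambda>m. K \<le> short_return m) sequentially"
        using eventually_ge_at_top[of "2 * K + 2"]
      proof eventually_elim
        case (elim m)
        then have "(2 * K + 2) div 2 \<le> m div 2" by (rule div_le_mono)
        then show ?case by (simp add: short_return_def)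
      qed
    qed
    show "eventually (\<lambda>m. 2 \<le> short_return m \<and> 2 \<le> long_return m) sequentially"
      using eventually_ge_at_top[of 2]
    proof eventually_elim
      case (elim m)
      then show ?case by (cases rule: even_odd_ge_2E) (use returns_even returns_odd in auto)
    qed
  qed
  then have "(\<lambda>m. P (1 + \<phi> (short_return m) (long_return m))) \<longlonglongrightarrow> P (1 + 0)"
    unfolding P_def using pos by (intro tendsto_intros) auto
  moreover have "eventually (\<lambda>m. P (1 + \<phi> (short_return m) (long_return m)) = S_period \<beta> (3 * m + 1)) sequentially"
    using eventually_ge_at_top[of 2] by eventually_elim (simp only: S_period_3m1)
  ultimately show ?thesis by (auto intro: Lim_transform_eventually)
qed

end

lemma tribonacci_base_tribonacci: "tribonacci_base tribonacci"
  using theI'[OF tribonacci_ex1] unfolding tribonacci_base_def tribonacci_def by blast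

theorem corollary5p5:
  fixes \<beta> :: real
  assumes "\<beta> = tribonacci"
  shows "(\<forall>m z :: nat. m = 2 * z \<and> 1 \<le> z \<longrightarrow>
      S_period \<beta> (3 * m + 1) =
        (1 + \<beta> + \<beta> ^ (3 * z + 2) - \<beta> ^ (3 * z + 1) - \<beta> ^ (6 * z) - \<beta> ^ (6 * z + 2)) /
        ((1 - \<beta> ^ 3) * (\<beta> ^ (6 * z + 1) - 1))) \<and>
    (\<forall>m z :: nat. m = 2 * z + 1 \<and> 1 \<le> z \<longrightarrow>
      S_period \<beta> (3 * m + 1) =
        (1 + \<beta> + \<beta> ^ (3 * z + 5) - \<beta> ^ (3 * z + 4) - \<beta> ^ (6 * z + 3) - \<beta> ^ (6 * z + 5)) /
        ((1 - \<beta> ^ 3) * (\<beta> ^ (6 * z + 4) - 1))) \<and>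
    strict_mono_on {2..} (\<lambda>m. S_period \<beta> (3 * m + 1)) \<and>
    (\<lambda>m. S_period \<beta> (3 * m + 1)) \<longlonglongrightarrow> (\<beta> ^ 2 + 1) / (\<beta> ^ 4 - \<beta>)"
proof -
  interpret tribonacci_base \<beta>
    using assms tribonacci_base_tribonacci by simp
  show ?thesis
    using S_period_even S_period_odd
    by (intro conjI S_period_strict_mono S_period_tendsto[unfolded P_1]) blast+
qed

end
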